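(* Let $G$ be a connected finite $\delta$-hyperbolic graph and $P(y,x)$ a shortest path from $y$ to $x$. Then $2\mathcal{U}(P(y,x))+\mathcal{H}(P(y,x))\le\max\{0,4\delta-1\}$ if $P(y,x)$ is strict end-minimal, and $2\mathcal{U}(P(y,x))+\mathcal{H}(P(y,x))\le 4\delta+1$ if $P(y,x)$ is end-minimal. Moreover, for a vertex $x'$ of $P(y,x)$, $2\mathcal{U}(P(y,x'))+\mathcal{H}(P(y,x'))\le 2\delta$ if $e(x')>e(x)+\delta$, or if $P(y,x)$ is end-minimal and $d(x,x')>2\delta$.
   Context: $G$ is $\delta$-hyperbolic if for any four vertices $u,v,w,x$ the two larger of $d(u,v)+d(w,x)$, $d(u,w)+d(v,x)$, $d(u,x)+d(v,w)$ differ by at most $2\delta$ ($d$ = shortest-path distance). $e(v)=\max_u d(v,u)$. Along a path from $y$ to $x$, an ordered edge $(a,b)$ is an up-edge if $e(a)<e(b)$, horizontal if $e(a)=e(b)$; $\mathcal{U}(P)$ and $\mathcal{H}(P)$ count up-edges and horizontal-edges of a path $P$ (traversed from its first to last vertex); $P(y,x')$ is the subpath of $P(y,x)$ from $y$ to $x'$. $P(y,x)$ is end-minimal if $e(x)\le e(v)$ for all $v\in P(y,x)$, strict end-minimal if $e(x)<e(v)$ for all $v\ne x$ on it. *)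

theory Defs
  imports "Graph_Theory.Graph_Theory"
begin

(* The infimum of walk costs is an extended real; it is finite whenever v is reachable from u. *)
definition gdist :: "('a, 'b) pre_digraph \<Rightarrow> 'a \<Rightarrow> 'a \<Rightarrow> real" where
  "gdist G u v = real_of_ereal (wf_digraph.\<mu> G (\<lambda>_. 1) u v)"

lemma gdist_le_walk:
  assumes "fin_digraph G" and "pre_digraph.awalk G u p v"
  shows "gdist G u v \<le> real (length p)"
proof -
  interpret fin_digraph G by fact
  have cost: "awalk_cost (\<lambda>_. 1) q = real (length q)" for q
    by (simp add: awalk_cost_def sum_list_triv)
  have "u \<rightarrow>\<^sup>*\<^bsub>G\<^esub> v" using assms(2) by (auto simp: reachable_awalk)
  then obtain q where "\<mu> (\<lambda>_. 1) u v = ereal (awalk_cost (\<lambda>_. 1) q)"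
    using min_cost_awalk[of u v "\<lambda>_. 1"] by auto
  with min_cost_le_walk_cost[OF assms(2), of "\<lambda>_. 1"] show ?thesis
    by (simp add: gdist_def cost)
qed

lemma gdist_attained:
  assumes "fin_digraph G" and "u \<rightarrow>\<^sup>*\<^bsub>G\<^esub> v"
  shows "\<exists>p. pre_digraph.apath G u p v \<and> real (length p) = gdist G u v"
proof -
  interpret fin_digraph G by fact
  have cost: "awalk_cost (\<lambda>_. 1) q = real (length q)" for q
    by (simp add: awalk_cost_def sum_list_triv)
  show ?thesis
    using min_cost_awalk[OF assms(2), of "\<lambda>_. 1"] by (auto simp: gdist_def cost)
qed

definition eccentricity :: "('a, 'b) pre_digraph \<Rightarrow> 'a \<Rightarrow> real" where
  "eccentricity G v = Max ((\<lambda>u. gdist G v u) ` verts G)"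

(* The list is sorted increasingly, so its entries 2 and 1 are the two larger sums. *)
definition hyperbolic :: "real \<Rightarrow> ('a, 'b) pre_digraph \<Rightarrow> bool" where
  "hyperbolic \<delta> G \<longleftrightarrow>
     (\<forall>u\<in>verts G. \<forall>v\<in>verts G. \<forall>w\<in>verts G. \<forall>x\<in>verts G.
        let s = sort [gdist G u v + gdist G w x,
                      gdist G u w + gdist G v x,
                      gdist G u x + gdist G v w]
        in s ! 2 - s ! 1 \<le> 2 * \<delta>)"

definition shortest_path :: "('a, 'b) pre_digraph \<Rightarrow> 'a \<Rightarrow> 'b awalk \<Rightarrow> 'a \<Rightarrow> bool" where
  "shortest_path G y P x \<longleftrightarrow>
     pre_digraph.apath G y P x \<and> real (length P) = gdist G y x"

definition up_edges :: "('a, 'b) pre_digraph \<Rightarrow> 'b awalk \<Rightarrow> nat" where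
  "up_edges G P =
     length (filter (\<lambda>a. eccentricity G (tail G a) < eccentricity G (head G a)) P)"

definition horizontal_edges :: "('a, 'b) pre_digraph \<Rightarrow> 'b awalk \<Rightarrow> nat" where
  "horizontal_edges G P =
     length (filter (\<lambda>a. eccentricity G (tail G a) = eccentricity G (head G a)) P)"

definition end_minimal :: "('a, 'b) pre_digraph \<Rightarrow> 'a \<Rightarrow> 'b awalk \<Rightarrow> 'a \<Rightarrow> bool" where
  "end_minimal G y P x \<longleftrightarrow>
     (\<forall>v\<in>set (pre_digraph.awalk_verts G y P). eccentricity G x \<le> eccentricity G v)"

definition strict_end_minimal :: "('a, 'b) pre_digraph \<Rightarrow> 'a \<Rightarrow> 'b awalk \<Rightarrow> 'a \<Rightarrow> bool" where
  "strict_end_minimal G y P x \<longleftrightarrow>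
     (\<forall>v\<in>set (pre_digraph.awalk_verts G y P). v \<noteq> x \<longrightarrow> eccentricity G x < eccentricity G v)"

(* The subpath of P from its first vertex to its vertex v: the arcs preceding the one that
   leaves v, hence all of P when v is its last vertex (a path visits v only once). *)
definition subpath_to :: "('a, 'b) pre_digraph \<Rightarrow> 'b awalk \<Rightarrow> 'a \<Rightarrow> 'b awalk" where
  "subpath_to G P v = takeWhile (\<lambda>a. tail G a \<noteq> v) P"

lemma awalk_subpath_to:
  assumes "wf_digraph G" and "pre_digraph.awalk G y P x"
    and "v \<in> set (pre_digraph.awalk_verts G y P)"
  shows "pre_digraph.awalk G y (subpath_to G P v) v"
proof -
  interpret wf_digraph G by fact
  show ?thesis
    using assms(2,3)
    by (induction P arbitrary: y) (auto simp: subpath_to_def awalk_Nil_iff awalk_Cons_iff)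
qed

end

theory Submission
  imports Defs
begin

text \<open>
  Along a shortest path from \<open>y\<close> to \<open>x\<close> every edge changes the eccentricity by at most one, so
  \<open>2 U + H = d(y,x) + e(x) - e(y)\<close>.  For \<open>x'\<close> on the path and \<open>v\<close> farthest from \<open>x'\<close>,
  compare the three distance sums of \<open>y, x, x', v\<close>: once \<open>d(x,x') + e(x') - e(x) > 2 \<delta>\<close>, the sum
  \<open>d(y,x) + d(x',v)\<close> exceeds \<open>d(y,x') + d(x,v)\<close> by more than \<open>2 \<delta>\<close>, hence it exceeds
  \<open>d(x,x') + d(y,v)\<close> by at most \<open>2 \<delta>\<close>, which says \<open>d(y,x') + e(x') - e(y) \<le> 2 \<delta>\<close>.  The bounds on
  the whole path follow by choosing \<open>x'\<close> as close to \<open>x\<close> as this condition allows.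
\<close>

text \<open>If \<open>a\<close> is the largest, entry 1 of the sorted list is
  \<open>max b c\<close>; otherwise \<open>a\<close> is at most \<open>max b c\<close> already, and
  \<open>0 \<le> k\<close> suffices.\<close>

lemma sort_three_max_diff:
  fixes a b c :: real
  assumes "(let s = sort [a, b, c] in s ! 2 - s ! 1) \<le> k" and "0 \<le> k"
  shows "a \<le> max b c + k"
  using assms by (auto simp: Let_def numeral_2_eq_2 split: if_splits)

lemma hyperbolic_four_point:
  assumes "hyperbolic \<delta> G" and "0 \<le> \<delta>"
    and "u \<in> verts G" "v \<in> verts G" "w \<in> verts G" "x \<in> verts G"
  shows "gdist G u v + gdist G w x
    \<le> max (gdist G u w + gdist G v x) (gdist G u x + gdist G v w) + 2 * \<delta>"
proof (rule sort_three_max_diff)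
  show "(let s = sort [gdist G u v + gdist G w x, gdist G u w + gdist G v x,
      gdist G u x + gdist G v w] in s ! 2 - s ! 1) \<le> 2 * \<delta>"
    using assms(1,3-6) unfolding hyperbolic_def Let_def by blast
qed (use assms(2) in simp)

section \<open>Distances in a finite connected graph with symmetric arcs\<close>

locale connected_graph = graph G for G :: "('a, 'b) pre_digraph" +
  assumes conn: "connected G"
begin

abbreviation "d \<equiv> gdist G"
abbreviation "e \<equiv> eccentricity G"

lemma reachable_all: "u \<in> verts G \<Longrightarrow> v \<in> verts G \<Longrightarrow> u \<rightarrow>\<^sup>*\<^bsub>G\<^esub> v"
  \<comment> \<open>Connectedness is strong connectedness of the symmetric closure; as the arcs are
    already symmetric, reachability there is reachability in \<open>G\<close>.\<close>
  using conn reachable_mk_symmetric_eq[OF sym_arcs]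
  by (auto simp: connected_def strongly_connected_def)

lemma dist_le: "awalk u p v \<Longrightarrow> d u v \<le> real (length p)"
  by (rule gdist_le_walk) unfold_locales

lemma dist_walk:
  assumes "u \<in> verts G" "v \<in> verts G"
  obtains p where "awalk u p v" "d u v = real (length p)"
  using gdist_attained[OF fin_digraph_axioms reachable_all[OF assms]]
  by (auto simp: apath_def)

lemma dist_nonneg: "u \<in> verts G \<Longrightarrow> v \<in> verts G \<Longrightarrow> 0 \<le> d u v"
  by (erule (1) dist_walk) simp

lemma dist_self: "u \<in> verts G \<Longrightarrow> d u u = 0"
  using dist_le[of u "[]" u] dist_nonneg[of u u] by (auto simp: awalk_Nil_iff)

lemma dist_triangle:
  assumes "u \<in> verts G" "v \<in> verts G" "w \<in> verts G"
  shows "d u w \<le> d u v + d v w"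
proof -
  obtain p q where "awalk u p v" "d u v = real (length p)" "awalk v q w" "d v w = real (length q)"
    using assms by (meson dist_walk)
  then show ?thesis using dist_le[of u "p @ q" w] by auto
qed

lemma start_in_awalk_verts: "awalk u p v \<Longrightarrow> u \<in> set (awalk_verts u p)"
  by (cases p) (auto simp: awalk_Cons_iff)

lemma awalk_rev: "awalk u p v \<Longrightarrow> \<exists>q. awalk v q u \<and> length q = length p"
proof (induction p arbitrary: u)
  case (Cons a p)
  then obtain q where q: "awalk v q (head G a)" "length q = length p"
    by (auto simp: awalk_Cons_iff)
  obtain b where "b \<in> arcs G" "tail G b = head G a" "head G b = tail G a"
    using Cons.prems sym_arcs by (fastforce simp: awalk_Cons_iff symmetric_conv)
  with q Cons.prems show ?case
    by (intro exI[of _ "q @ [b]"]) (auto simp: awalk_Cons_iff awalk_simps)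
qed (auto simp: awalk_Nil_iff)

lemma dist_sym:
  assumes "u \<in> verts G" "v \<in> verts G"
  shows "d u v = d v u"
proof -
  have "d s t \<le> d t s" if "s \<in> verts G" "t \<in> verts G" for s t
    using that by (metis awalk_rev dist_le dist_walk)
  then show ?thesis using assms by (simp add: antisym)
qed

section \<open>Eccentricities and their change along an edge\<close>

lemma dist_le_ecc: "u \<in> verts G \<Longrightarrow> v \<in> verts G \<Longrightarrow> d u v \<le> e u"
  unfolding eccentricity_def by (rule Max_ge) auto

lemma ecc_attained:
  assumes "u \<in> verts G"
  obtains v where "v \<in> verts G" "e u = d u v"
proof -
  have "e u \<in> d u ` verts G"
    unfolding eccentricity_def using assms by (intro Max_in) auto
  then show ?thesis using that by blast
qed

lemma ecc_nat:
  assumes "u \<in> verts G"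
  obtains n :: nat where "e u = real n"
  using assms by (metis dist_walk ecc_attained)

lemma ecc_triangle:
  assumes "u \<in> verts G" "v \<in> verts G"
  shows "e u \<le> d u v + e v"
proof -
  obtain w where "w \<in> verts G" "e u = d u w"
    using assms ecc_attained by blast
  then show ?thesis using dist_triangle[of u v w] dist_le_ecc[of v w] assms by linarith
qed

text \<open>Eccentricities at the two ends of an arc differ by at most 1 by the triangle inequality,
  and they are integers.\<close>

lemma edge_cases:
  assumes "a \<in> arcs G"
  shows "e (head G a) = e (tail G a) + 1 \<or> e (head G a) = e (tail G a)
    \<or> e (head G a) = e (tail G a) - 1"
proof -
  let ?t = "tail G a" and ?h = "head G a"
  have v: "?t \<in> verts G" "?h \<in> verts G" using assms by auto
  have "d ?t ?h \<le> 1"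
    using dist_le[of ?t "[a]" ?h] assms by (auto simp: awalk_Cons_iff awalk_Nil_iff)
  then have "e ?t \<le> 1 + e ?h" "e ?h \<le> 1 + e ?t"
    using ecc_triangle[of ?t ?h] ecc_triangle[of ?h ?t] dist_sym v by fastforce+
  moreover obtain m n :: nat where "e ?t = real m" "e ?h = real n"
    using v by (metis ecc_nat)
  ultimately show ?thesis by auto
qed

text \<open>An arc contributes \<open>1 + e (head G a) - e (tail G a)\<close>, which is 2, 1 or 0
  for an up-, horizontal or down-edge; summed over any walk, the eccentricities telescope.\<close>

lemma up_horizontal_count:
  assumes "awalk u p v"
  shows "2 * real (up_edges G p) + real (horizontal_edges G p) = real (length p) + e v - e u"
  using assms
proof (induction p arbitrary: u)
  case Nil
  then show ?case by (simp add: awalk_Nil_iff up_edges_def horizontal_edges_def)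
next
  case (Cons a p)
  then have "2 * real (up_edges G p) + real (horizontal_edges G p)
      = real (length p) + e v - e (head G a)" and "a \<in> arcs G" "tail G a = u"
    by (auto simp: awalk_Cons_iff)
  with edge_cases[of a] show ?case
    by (auto simp: up_edges_def horizontal_edges_def)
qed

section \<open>Cutting a shortest path at a vertex\<close>

lemma shortest_append:
  assumes "awalk y p z" "awalk z q x" "d y x = real (length (p @ q))"
  shows "d y z = real (length p)" "d z x = real (length q)"
proof -
  have "d y x \<le> d y z + d z x"
    using assms by (intro dist_triangle) auto
  \<comment> \<open>Both distances are bounded by the lengths of the pieces, and their sum is at
    least the total length, so both bounds are tight.\<close>
  with dist_le[OF assms(1)] dist_le[OF assms(2)] assms(3)
  show "d y z = real (length p)" "d z x = real (length q)" by auto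
qed

lemma shortest_path_vertex:
  assumes "shortest_path G y P x" "k \<le> length P"
  obtains z where "z \<in> set (awalk_verts y P)" "d y x = d y z + d z x" "d z x = real k"
proof -
  let ?p = "take (length P - k) P" and ?q = "drop (length P - k) P"
  have P: "awalk y (?p @ ?q) x" "d y x = real (length (?p @ ?q))"
    using assms by (auto simp: shortest_path_def apath_def)
  then obtain z where z: "awalk y ?p z" "awalk z ?q x"
    using awalk_append_iff by blast
  have "z \<in> set (awalk_verts y (?p @ ?q))"
    unfolding set_awalk_verts_append[OF z] using start_in_awalk_verts[OF z(2)] by blast
  with shortest_append[OF z P(2)] assms(2) P(2) show ?thesis
    by (intro that[of z]) auto
qed

lemma shortest_path_subpath_to:
  assumes "shortest_path G y P x" "z \<in> set (awalk_verts y P)"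
  shows "awalk y (subpath_to G P z) z" "d y z = real (length (subpath_to G P z))"
    "d y x = d y z + d z x"
proof -
  let ?p = "subpath_to G P z" and ?q = "dropWhile (\<lambda>a. tail G a \<noteq> z) P"
  have P: "awalk y (?p @ ?q) x" "d y x = real (length (?p @ ?q))"
    using assms by (simp_all add: shortest_path_def apath_def subpath_to_def del: length_append)
  show p: "awalk y ?p z"
    using assms wf_digraph_axioms
    by (intro awalk_subpath_to) (auto simp: shortest_path_def apath_def)
  \<comment> \<open>The whole walk splits where \<open>?p\<close> ends, and \<open>p\<close>
    identifies that vertex as \<open>z\<close>.\<close>
  with P(1) have q: "awalk z ?q x"
    by (metis awalk_append_iff awalk_ends awalkE' awalkE)
  show "d y z = real (length ?p)" "d y x = d y z + d z x"
    using shortest_append[OF p q P(2)] P(2) by simp_all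
qed

section \<open>Excess bounds from hyperbolicity\<close>

lemma hyperbolic_nonneg: "hyperbolic \<delta> G \<Longrightarrow> u \<in> verts G \<Longrightarrow> 0 \<le> \<delta>"
  \<comment> \<open>Taking all four vertices equal to \<open>u\<close> makes the three sums
    vanish.\<close>
  unfolding hyperbolic_def by (drule bspec[of _ _ u], assumption)+ (auto simp: Let_def dist_self numeral_2_eq_2)

text \<open>By \<open>up_horizontal_count\<close>, the bounded quantity is the weighted edge count
  of a shortest path from \<open>y\<close> to \<open>z\<close>.\<close>

lemma hyperbolic_excess_bound:
  assumes "hyperbolic \<delta> G" "x \<in> verts G" "y \<in> verts G" "z \<in> verts G"
    and "d y x = d y z + d z x" and far: "d z x + e z - e x > 2 * \<delta>"
  shows "d y z + e z - e y \<le> 2 * \<delta>"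
proof -
  obtain v where v: "v \<in> verts G" "e z = d z v"
    using assms ecc_attained by blast
  have "d y x + d z v \<le> max (d y z + d x v) (d y v + d x z) + 2 * \<delta>"
    using assms v by (intro hyperbolic_four_point hyperbolic_nonneg)
  moreover have "d x v \<le> e x" "d y v \<le> e y" "d x z = d z x"
    using assms v by (auto intro: dist_le_ecc dist_sym)
  \<comment> \<open>\<open>far\<close> excludes the first argument of \<open>max\<close>; in the
    second, \<open>d z x\<close> cancels against its share of \<open>d y x\<close>.\<close>
  ultimately show ?thesis using assms(5) far v by linarith
qed

lemma end_minimal_excess:
  assumes hyp: "hyperbolic \<delta> G" and sp: "shortest_path G y P x"
    and min: "end_minimal G y P x"
  shows "d y x + e x - e y \<le> 4 * \<delta> + 1"
proof -
  have walk: "awalk y P x" and len: "d y x = real (length P)"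
    using sp by (auto simp: shortest_path_def apath_def)
  have V: "x \<in> verts G" "y \<in> verts G" using walk by auto
  have nn: "0 \<le> \<delta>" using hyp V hyperbolic_nonneg by blast
  have le: "e x \<le> e z" if "z \<in> set (awalk_verts y P)" for z
    using min that by (auto simp: end_minimal_def)
  \<comment> \<open>The least integer above \<open>2 * \<delta>\<close>: since
    \<open>e x \<le> e z\<close>, a vertex \<open>z\<close> at this distance from \<open>x\<close>
    satisfies the \<open>far\<close> condition, and the last \<open>k\<close> arcs add at most
    \<open>2 * \<delta> + 1\<close>.\<close>
  define k where "k = nat \<lfloor>2 * \<delta>\<rfloor> + 1"
  have k: "2 * \<delta> < real k" "real k \<le> 2 * \<delta> + 1" using nn by (auto simp: k_def) linarith+
  show ?thesis
  proof (cases "k \<le> length P")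
    case True
    then obtain z where z: "z \<in> set (awalk_verts y P)" "d y x = d y z + d z x" "d z x = real k"
      using sp shortest_path_vertex by blast
    have "d y z + e z - e y \<le> 2 * \<delta>"
      using z k le[of z] V walk awalk_verts_in_verts hyp by (intro hyperbolic_excess_bound) auto
    with z k le[of z] show ?thesis by linarith
  next
    case False
    then have "length P \<le> nat \<lfloor>2 * \<delta>\<rfloor>" by (simp add: k_def)
    then have "real (length P) \<le> 2 * \<delta>" using nn by linarith
    then show ?thesis
      using len nn le[OF start_in_awalk_verts[OF walk]] by linarith
  qed
qed

lemma strict_end_minimal_excess:
  assumes hyp: "hyperbolic \<delta> G" and sp: "shortest_path G y P x"
    and min: "strict_end_minimal G y P x"
  shows "d y x + e x - e y \<le> max 0 (4 * \<delta> - 1)"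
proof (cases "y = x")
  case True
  moreover have "x \<in> verts G" using sp by (auto simp: shortest_path_def apath_def)
  ultimately show ?thesis by (simp add: dist_self)
next
  case False
  have walk: "awalk y P x" and len: "d y x = real (length P)"
    using sp by (auto simp: shortest_path_def apath_def)
  have V: "x \<in> verts G" "y \<in> verts G" using walk by auto
  have nn: "0 \<le> \<delta>" using hyp V hyperbolic_nonneg by blast
  \<comment> \<open>Integrality turns strict minimality into a gap of 1.\<close>
  have less: "e x + 1 \<le> e z" if "z \<in> set (awalk_verts y P)" "z \<noteq> x" for z
  proof -
    have "z \<in> verts G" using that(1) walk awalk_verts_in_verts by blast
    then obtain m n :: nat where "e x = real m" "e z = real n" using V by (metis ecc_nat)
    moreover have "e x < e z" using min that by (auto simp: strict_end_minimal_def)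
    ultimately show ?thesis by simp
  qed
  have ends: "y \<in> set (awalk_verts y P)" using walk start_in_awalk_verts by blast
  \<comment> \<open>The gap of 1 in \<open>less\<close> lets \<open>k + 1\<close> rather than
    \<open>k\<close> exceed \<open>2 * \<delta>\<close>. The \<open>max 1\<close> keeps
    \<open>z\<close> different from \<open>x\<close>, so that \<open>less\<close> applies.\<close>
  define k where "k = max 1 (nat \<lfloor>2 * \<delta>\<rfloor>)"
  have k: "2 * \<delta> < real k + 1" "real k \<le> max 1 (2 * \<delta>)" "1 \<le> k"
    using nn by (auto simp: k_def) linarith+
  show ?thesis
  proof (cases "k \<le> length P")
    case True
    then obtain z where z: "z \<in> set (awalk_verts y P)" "d y x = d y z + d z x" "d z x = real k"
      using sp shortest_path_vertex by blast
    have "z \<noteq> x" using z(3) k(3) V dist_self[of x] by auto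
    note lz = less[OF z(1) this]
    have "d y z + e z - e y \<le> 2 * \<delta>"
      using z k lz V walk awalk_verts_in_verts hyp by (intro hyperbolic_excess_bound) auto
    then have b: "d y x + e x - e y \<le> 2 * \<delta> + real k - 1" using z lz by linarith
    show ?thesis
    \<comment> \<open>If \<open>2 * \<delta> < 1\<close>, then \<open>k = 1\<close> and the excess
      is an integer below 1, hence at most 0. Otherwise \<open>k \<le> 2 * \<delta>\<close> and
      \<open>b\<close> gives \<open>4 * \<delta> - 1\<close>.\<close>
    proof (cases "2 * \<delta> < 1")
      case True
      obtain m n :: nat where mn: "e x = real m" "e y = real n" using V by (metis ecc_nat)
      have "d y x + e x - e y < 1" using b k True by linarith
      then have "real (length P + m) < real (n + 1)" using len mn by simp
      then have "length P + m \<le> n" unfolding of_nat_less_iff by simp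
      then have "real (length P + m) \<le> real n" by (simp only: of_nat_le_iff)
      then show ?thesis using len mn by simp
    next
      case False
      then show ?thesis using b k by linarith
    qed
  next
    case F: False
    have "P \<noteq> []" using \<open>y \<noteq> x\<close> walk by (auto simp: awalk_Nil_iff)
    then have "1 \<le> length P" by (cases P) auto
    \<comment> \<open>Since \<open>k\<close> exceeds a length of at least 1, it must be the floor of
      \<open>2 * \<delta>\<close>.\<close>
    with F have "length P + 1 \<le> nat \<lfloor>2 * \<delta>\<rfloor>" by (simp add: k_def)
    then have "real (length P) \<le> 2 * \<delta>" using nn by linarith
    moreover have "1 \<le> real (length P)" using \<open>1 \<le> length P\<close> by simp
    ultimately show ?thesis
      using len less[OF ends \<open>y \<noteq> x\<close>] by linarith
  qed
qed

end

theorem theorem20: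
  fixes G :: "('a, 'b) pre_digraph" and \<delta> :: real and x y :: 'a and P :: "'b awalk"
  assumes "graph G" and "Digraph_Component.connected G" and "hyperbolic \<delta> G"
    and "shortest_path G y P x"
  shows "(strict_end_minimal G y P x \<longrightarrow>
            2 * real (up_edges G P) + real (horizontal_edges G P) \<le> max 0 (4 * \<delta> - 1))
       \<and> (end_minimal G y P x \<longrightarrow>
            2 * real (up_edges G P) + real (horizontal_edges G P) \<le> 4 * \<delta> + 1)
       \<and> (\<forall>x'\<in>set (pre_digraph.awalk_verts G y P).
            eccentricity G x' > eccentricity G x + \<delta>
            \<or> end_minimal G y P x \<and> gdist G x x' > 2 * \<delta> \<longrightarrow>
              2 * real (up_edges G (subpath_to G P x'))
                + real (horizontal_edges G (subpath_to G P x')) \<le> 2 * \<delta>)"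
proof -
  interpret connected_graph G
    using assms(1,2) by (intro connected_graph.intro connected_graph_axioms.intro)
  have walk: "awalk y P x" and len: "d y x = real (length P)"
    using assms(4) by (auto simp: shortest_path_def apath_def)
  have V: "x \<in> verts G" "y \<in> verts G" using walk by auto
  have "2 * real (up_edges G (subpath_to G P z)) + real (horizontal_edges G (subpath_to G P z))
      \<le> 2 * \<delta>"
    if z: "z \<in> set (awalk_verts y P)"
      and c: "e z > e x + \<delta> \<or> end_minimal G y P x \<and> d x z > 2 * \<delta>" for z
  proof -
    have zV: "z \<in> verts G" using z walk awalk_verts_in_verts by blast
    note sub = shortest_path_subpath_to[OF assms(4) z]
    \<comment> \<open>In the first case \<open>d z x \<ge> e z - e x\<close>, so both
      \<open>d z x\<close> and \<open>e z - e x\<close> exceed \<open>\<delta>\<close>; in the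
      second, \<open>d z x\<close> alone suffices because \<open>e x \<le> e z\<close>.\<close>
    have "d z x + e z - e x > 2 * \<delta>"
      using c ecc_triangle[OF zV V(1)] dist_sym[OF zV V(1)] z by (auto simp: end_minimal_def)
    then have "d y z + e z - e y \<le> 2 * \<delta>"
      using assms(3) V zV sub(3) by (intro hyperbolic_excess_bound)
    then show ?thesis using up_horizontal_count[OF sub(1)] sub(2) by linarith
  qed
  then show ?thesis
    using up_horizontal_count[OF walk] len end_minimal_excess[OF assms(3,4)]
      strict_end_minimal_excess[OF assms(3,4)] by auto
qed

end
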